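(* Let $\mathcal M$ be a countable Markov system on a complete metric space $(K,d)$, and let $\mathcal M^1$ and $\mathcal M^2$ be connecting refinements of $\mathcal M$. If $\mathcal M^1$ and $\mathcal M^2$ satisfy the absolute continuity condition, then $\mathcal M$ satisfies the absolute continuity condition also.
   Context: Markov system. A Markov system $\mathcal M=(K_{i(e)},w_e,p_e)_{e\in E}$ on a metric space $(K,d)$ consists of: an at most countable set $E$; Borel measurable maps $w_e:K\to K$ and Borel measurable probability functions $p_e:K\to[0,1]$ ($e\in E$), with $\sum_{e\in E}p_e(x)=1$ for all $x\in K$; a partition $(K_i)_{i\in N}$ of $K$ into non-empty Borel sets (the vertex sets); and maps $i,t:E\to N$, with $i$ surjective, such that $\emptyset\neq\{p_e>0\}\subset K_{i(e)}$ and $w_e(K_{i(e)})\subset K_{t(e)}$ for all $e\in E$. It is countable if $N$ is at most countable. Path measures and absolute continuity condition. Let $\bar E=E\cup\{\infty\}$ be the one-point compactification of the discrete space $E$, with $w_\infty:=\mathrm{id}$, $p_\infty:=0$, and let $\Sigma^+:=\bar E^{\mathbb N}$ carry the product topology and its Borel $\sigma$-algebra; put ${}_1[e_1,\dots,e_k]^+:=\{\sigma\in\Sigma^+:\sigma_1=e_1,\dots,\sigma_k=e_k\}$. For $x\in K$, $P_x$ is the Borel probability measure on $\Sigma^+$ with $P_x({}_1[e_1,\dots,e_k]^+)=p_{e_1}(x)p_{e_2}(w_{e_1}x)\cdots p_{e_k}(w_{e_{k-1}}\circ\cdots\circ w_{e_1}x)$. $\mathcal M$ satisfies the absolute continuity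 condition if $P_x\ll P_y$ for all $i\in N$ and all $x,y\in K_i$. For a refinement of $\mathcal M$, the condition is understood with the refinement's own edge set, vertex sets and path measures. Refinement. A Markov system $\mathcal M^r=(K^r_{i(e)},w^r_e,p^r_e)_{e\in E^r}$ (with set of vertices $N^r$ and maps again denoted $i,t:E^r\to N^r$) is a refinement of $\mathcal M$ if and only if the partition $\{K^r_{i(e)}\}_{e\in E^r}$ refines the partition $\{K_{i(e)}\}_{e\in E}$ (i.e. each $K_i$ is a union of some $K^r_j$'s) and there is a surjective map $r:E^r\to E$ such that $w_{r(e)}|_{K^r_{i(e)}}=w^r_e|_{K^r_{i(e)}}$ and $p_{r(e)}|_{K^r_{i(e)}}=p^r_e|_{K^r_{i(e)}}$ for all $e\in E^r$. Connecting refinements. Refinements $\mathcal M^1$ and $\mathcal M^2$ of $\mathcal M$ (with vertex sets $(K^1_j)_{j\in N^1}$ and $(K^2_j)_{j\in N^2}$) are connecting if and only if for every $i\in N$ and $x,y\in K_i$ there exist $j_1,\dots,j_n\in N^1$ and $j'_1,\dots,j'_n\in N^2$ such that $x\in K^1_{j_1}$ and $y\in K^2_{j'_n}$, and $K^1_{j_m}\cap K^2_{j'_m}\neq\emptyset$ and $K^1_{j_m}\cap K^2_{j'_{m+1}}\neq\emptyset$ for all $m=1,\dots,n-1$.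
   Formalization: In a refinement, r is also required to be injective on the edges starting at each vertex of the refinement, and connecting chains must have n at least 2; without either condition the lemma is false. *)

theory Defs
  imports "HOL-Probability.Probability"
begin

(* The space K is the whole type 'a. Edges and vertices are carrier sets, since refinements
   come with index sets of their own. *)
record ('a, 'v, 'e) markov_data =
  edges :: "'e set"
  vertices :: "'v set"
  initv :: "'e \<Rightarrow> 'v"
  termv :: "'e \<Rightarrow> 'v"
  cell :: "'v \<Rightarrow> 'a set"
  wmap :: "'e \<Rightarrow> 'a \<Rightarrow> 'a"
  pfun :: "'e \<Rightarrow> 'a \<Rightarrow> real"

definition markov_system :: "('a::metric_space, 'v, 'e) markov_data \<Rightarrow> bool" where
  "markov_system M \<longleftrightarrow>
     countable (edges M) \<and>
     (\<forall>e\<in>edges M. wmap M e \<in> borel_measurable borel) \<and>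
     (\<forall>e\<in>edges M. pfun M e \<in> borel_measurable borel \<and> (\<forall>x. 0 \<le> pfun M e x \<and> pfun M e x \<le> 1)) \<and>
     (\<forall>x. ((\<lambda>e. pfun M e x) has_sum 1) (edges M)) \<and>
     (\<forall>i\<in>vertices M. cell M i \<noteq> {} \<and> cell M i \<in> sets borel) \<and>
     disjoint_family_on (cell M) (vertices M) \<and>
     (\<Union>i\<in>vertices M. cell M i) = UNIV \<and>
     initv M ` edges M = vertices M \<and>
     termv M ` edges M \<subseteq> vertices M \<and>
     (\<forall>e\<in>edges M. {x. pfun M e x > 0} \<noteq> {} \<and> {x. pfun M e x > 0} \<subseteq> cell M (initv M e)) \<and>
     (\<forall>e\<in>edges M. wmap M e ` cell M (initv M e) \<subseteq> cell M (termv M e))"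

definition countable_markov_system :: "('a::metric_space, 'v, 'e) markov_data \<Rightarrow> bool" where
  "countable_markov_system M \<longleftrightarrow> markov_system M \<and> countable (vertices M)"

(* None is the point at infinity of the one-point compactification of the discrete edge set. *)
definition path_topology :: "('a, 'v, 'e) markov_data \<Rightarrow> (nat \<Rightarrow> 'e option) topology" where
  "path_topology M =
     product_topology (\<lambda>_. Alexandroff_compactification (discrete_topology (edges M))) UNIV"

definition path_algebra :: "('a, 'v, 'e) markov_data \<Rightarrow> (nat \<Rightarrow> 'e option) measure" where
  "path_algebra M = sigma (topspace (path_topology M)) {U. openin (path_topology M) U}"

definition wmap_ext :: "('a, 'v, 'e) markov_data \<Rightarrow> 'e option \<Rightarrow> 'a \<Rightarrow> 'a" where
  "wmap_ext M e = (case e of None \<Rightarrow> id | Some e' \<Rightarrow> wmap M e')"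

definition pfun_ext :: "('a, 'v, 'e) markov_data \<Rightarrow> 'e option \<Rightarrow> 'a \<Rightarrow> real" where
  "pfun_ext M e = (case e of None \<Rightarrow> (\<lambda>_. 0) | Some e' \<Rightarrow> pfun M e')"

fun path_weight :: "('a, 'v, 'e) markov_data \<Rightarrow> 'a \<Rightarrow> 'e option list \<Rightarrow> real" where
  "path_weight M x [] = 1"
| "path_weight M x (e # es) = pfun_ext M e x * path_weight M (wmap_ext M e x) es"

(* Coordinates of paths are counted from 0 here. *)
definition cylinder :: "('a, 'v, 'e) markov_data \<Rightarrow> 'e option list \<Rightarrow> (nat \<Rightarrow> 'e option) set" where
  "cylinder M es = {\<sigma> \<in> topspace (path_topology M). \<forall>k<length es. \<sigma> k = es ! k}"

definition is_path_measure ::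
  "('a, 'v, 'e) markov_data \<Rightarrow> 'a \<Rightarrow> (nat \<Rightarrow> 'e option) measure \<Rightarrow> bool" where
  "is_path_measure M x P \<longleftrightarrow>
     prob_space P \<and> space P = space (path_algebra M) \<and> sets P = sets (path_algebra M) \<and>
     (\<forall>es. es \<noteq> [] \<and> set es \<subseteq> insert None (Some ` edges M) \<longrightarrow>
        measure P (cylinder M es) = path_weight M x es)"

(* For a Markov system this measure exists (Kolmogorov extension) and is unique (the cylinders
   form, with the empty set, an intersection-stable generator). *)
definition path_measure :: "('a, 'v, 'e) markov_data \<Rightarrow> 'a \<Rightarrow> (nat \<Rightarrow> 'e option) measure" where
  "path_measure M x = (THE P. is_path_measure M x P)"

(* The library's absolutely_continuous A B means that B is absolutely continuous w.r.t. A. *)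
definition absolute_continuity_condition :: "('a, 'v, 'e) markov_data \<Rightarrow> bool" where
  "absolute_continuity_condition M \<longleftrightarrow>
     (\<forall>i\<in>vertices M. \<forall>x\<in>cell M i. \<forall>y\<in>cell M i.
        absolutely_continuous (path_measure M y) (path_measure M x))"

(* The edges of R leaving a given vertex must have distinct images under r, i.e. R may split
   edges of M along its finer partition but may not duplicate an edge on one and the same cell.
   Without this, duplicating one edge can displace another (the probabilities still sum to 1),
   so that R and M have different dynamics: for K = {x1,x2,y1,y2} with a single vertex, all maps
   the identity, and edges a, b, c of probability 1/2 on K, {x1,x2}, {y1,y2} respectively, the
   cell {x1,y1} could carry two copies of a and no copy of b or c. *)
definition refinement ::
  "('a::metric_space, 'v, 'e) markov_data \<Rightarrow> ('a, 'w, 'f) markov_data \<Rightarrow> bool" where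
  "refinement M R \<longleftrightarrow>
     markov_system M \<and> markov_system R \<and>
     (\<forall>i\<in>vertices M. \<exists>J\<subseteq>vertices R. cell M i = (\<Union>j\<in>J. cell R j)) \<and>
     (\<exists>r. r ` edges R = edges M \<and>
        (\<forall>j\<in>vertices R. inj_on r {e \<in> edges R. initv R e = j}) \<and>
        (\<forall>e\<in>edges R. \<forall>x\<in>cell R (initv R e).
           wmap M (r e) x = wmap R e x \<and> pfun M (r e) x = pfun R e x))"

(* Chains have n \<ge> 2: for n = 1 the intersection conditions are void, and the relation between
   x and y would always hold. *)
definition connecting ::
  "('a::metric_space, 'v, 'e) markov_data \<Rightarrow> ('a, 'v1, 'e1) markov_data \<Rightarrow>
     ('a, 'v2, 'e2) markov_data \<Rightarrow> bool" where
  "connecting M R S \<longleftrightarrow>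
     refinement M R \<and> refinement M S \<and>
     (\<forall>i\<in>vertices M. \<forall>x\<in>cell M i. \<forall>y\<in>cell M i.
        \<exists>n\<ge>2. \<exists>j j'. j ` {1..n} \<subseteq> vertices R \<and> j' ` {1..n::nat} \<subseteq> vertices S \<and>
          x \<in> cell R (j 1) \<and> y \<in> cell S (j' n) \<and>
          (\<forall>m\<in>{1..n-1}. cell R (j m) \<inter> cell S (j' m) \<noteq> {} \<and>
                         cell R (j m) \<inter> cell S (j' (m + 1)) \<noteq> {}))"

end

theory Submission
  imports Defs
begin

text \<open>If R refines M along r, then applying r to every coordinate of a path carries the path measure
  of R at x to the path measure of M at x, so absolute continuity of R transports to absolute
  continuity of M within each single cell of R. A connecting chain moves from x to y through points
  of which any two consecutive ones share a cell of M1 or of M2, and absolute continuity is transitive.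

  For this, path measures must be known to exist (the Ionescu-Tulcea theorem) and to be unique
  (since there are countably many edges, the cylinders generate the Borel sets of path space).\<close>

section \<open>The Borel sets of path space\<close>

text \<open>The points of the one-point compactification as a bare set, so that it can also carry
  the discrete structure \<open>count_space\<close> used for the Ionescu-Tulcea
  construction.\<close>

definition alphabet :: "('a, 'v, 'e) markov_data \<Rightarrow> 'e option set" where
  "alphabet M = insert None (Some ` edges M)"

definition cylinders :: "('a, 'v, 'e) markov_data \<Rightarrow> (nat \<Rightarrow> 'e option) set set" where
  "cylinders M = cylinder M ` lists (alphabet M)"

lemma topspace_path_topology: "topspace (path_topology M) = UNIV \<rightarrow>\<^sub>E alphabet M"
  by (simp add: path_topology_def alphabet_def)

lemma cylinder_eq: "cylinder M es = {\<sigma> \<in> UNIV \<rightarrow>\<^sub>E alphabet M. \<forall>k<length es. \<sigma> k = es ! k}"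
  by (simp add: cylinder_def topspace_path_topology)

lemma cylinder_Nil: "cylinder M [] = UNIV \<rightarrow>\<^sub>E alphabet M"
  by (simp add: cylinder_eq)

lemma space_path_algebra: "space (path_algebra M) = UNIV \<rightarrow>\<^sub>E alphabet M"
  unfolding path_algebra_def topspace_path_topology[symmetric]
  by (rule space_measure_of) (auto dest: openin_subset)

lemma sets_path_algebra:
  "sets (path_algebra M) = sigma_sets (UNIV \<rightarrow>\<^sub>E alphabet M) {U. openin (path_topology M) U}"
  unfolding path_algebra_def topspace_path_topology[symmetric]
  by (rule sets_measure_of) (auto dest: openin_subset)

lemma countable_cylinders:
  assumes "countable (edges M)"
  shows "countable (cylinders M)"
  using assms by (simp add: cylinders_def alphabet_def)

text \<open>A basic open set restricts only finitely many coordinates.\<close>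

lemma openin_path_topology_contains_cylinder:
  assumes "openin (path_topology M) U" "\<sigma> \<in> U"
  shows "\<exists>n. cylinder M (map \<sigma> [0..<n]) \<subseteq> U"
proof -
  let ?X = "Alexandroff_compactification (discrete_topology (edges M))"
  obtain V where V: "finite {i. V i \<noteq> topspace ?X}" "\<sigma> \<in> Pi\<^sub>E UNIV V" "Pi\<^sub>E UNIV V \<subseteq> U"
    using assms unfolding path_topology_def openin_product_topology_alt by auto
  obtain n where n: "\<And>i. i \<in> {i. V i \<noteq> topspace ?X} \<Longrightarrow> i < n"
    using V(1) unfolding finite_nat_set_iff_bounded by blast
  have "cylinder M (map \<sigma> [0..<n]) \<subseteq> Pi\<^sub>E UNIV V"
  proof
    fix \<tau> assume "\<tau> \<in> cylinder M (map \<sigma> [0..<n])"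
    then have \<tau>: "\<tau> i \<in> topspace ?X" "i < n \<Longrightarrow> \<tau> i = \<sigma> i" for i
      by (auto simp: cylinder_eq alphabet_def PiE_iff)
    have "\<tau> i \<in> V i" for i
      using \<tau>[of i] n[of i] V(2) by (cases "i < n") (auto simp: PiE_iff)
    then show "\<tau> \<in> Pi\<^sub>E UNIV V" by (simp add: PiE_iff)
  qed
  with V(3) show ?thesis by blast
qed

text \<open>Around each of its points an open set contains a cylinder. Cylinders themselves need not
  be open, since \<open>{None}\<close> is not open when there are infinitely many edges.\<close>

lemma open_eq_Union_cylinders:
  assumes "openin (path_topology M) U"
  shows "U = \<Union>{C \<in> cylinders M. C \<subseteq> U}"
proof
  show "U \<subseteq> \<Union>{C \<in> cylinders M. C \<subseteq> U}"
  proof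
    fix \<sigma> assume \<sigma>: "\<sigma> \<in> U"
    then have sp: "\<sigma> \<in> UNIV \<rightarrow>\<^sub>E alphabet M"
      using openin_subset[OF assms] by (auto simp: topspace_path_topology)
    obtain n where n: "cylinder M (map \<sigma> [0..<n]) \<subseteq> U"
      using openin_path_topology_contains_cylinder[OF assms \<sigma>] by blast
    have "\<sigma> \<in> cylinder M (map \<sigma> [0..<n])" using sp by (simp add: cylinder_eq)
    moreover have "cylinder M (map \<sigma> [0..<n]) \<in> cylinders M"
      using sp unfolding cylinders_def by (intro imageI) (auto simp: PiE_iff)
    ultimately show "\<sigma> \<in> \<Union>{C \<in> cylinders M. C \<subseteq> U}" using n by blast
  qed
qed auto

text \<open>Edges are isolated points of the compactification, and the point at infinity is the
  complement of the open set of all edges.\<close>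

lemma singleton_measurable_alphabet:
  assumes "a \<in> alphabet M"
  shows "{\<sigma> \<in> UNIV \<rightarrow>\<^sub>E alphabet M. \<sigma> k = a} \<in> sets (path_algebra M)"
proof -
  let ?X = "Alexandroff_compactification (discrete_topology (edges M))"
  let ?S = "UNIV \<rightarrow>\<^sub>E alphabet M"
  have pre: "{\<sigma> \<in> ?S. \<sigma> k \<in> V} \<in> sets (path_algebra M)" if "openin ?X V" for V
  proof -
    have "continuous_map (path_topology M) ?X (\<lambda>\<sigma>. \<sigma> k)"
      unfolding path_topology_def
      by (rule continuous_map_product_projection[of k UNIV "\<lambda>_. ?X", simplified])
    from openin_continuous_map_preimage[OF this that]
    have "openin (path_topology M) {\<sigma> \<in> topspace (path_topology M). \<sigma> k \<in> V}" .
    then show ?thesis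
      unfolding sets_path_algebra topspace_path_topology by (intro sigma_sets.Basic) simp
  qed
  show ?thesis
  proof (cases a)
    case None
    have "{\<sigma> \<in> ?S. \<sigma> k = a} = space (path_algebra M) - {\<sigma> \<in> ?S. \<sigma> k \<in> Some ` edges M}"
      using None by (auto simp: space_path_algebra alphabet_def PiE_iff) (metis not_None_eq)
    also have "\<dots> \<in> sets (path_algebra M)"
      by (intro sets.compl_sets pre) simp
    finally show ?thesis .
  next
    case (Some e)
    then have "openin ?X (Some ` {e})"
      using assms by (subst openin_Alexandroff_compactification_image_Some) (auto simp: alphabet_def)
    from pre[OF this] show ?thesis using Some by simp
  qed
qed

lemma cylinder_measurable:
  assumes "set es \<subseteq> alphabet M"
  shows "cylinder M es \<in> sets (path_algebra M)"
proof -
  have "cylinder M es =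
      space (path_algebra M) \<inter> (\<Inter>k\<in>{..<length es}. {\<sigma> \<in> UNIV \<rightarrow>\<^sub>E alphabet M. \<sigma> k = es ! k})"
    if "es \<noteq> []"
    using that by (auto simp: cylinder_eq space_path_algebra)
  moreover have "(\<Inter>k\<in>{..<length es}. {\<sigma> \<in> UNIV \<rightarrow>\<^sub>E alphabet M. \<sigma> k = es ! k})
      \<in> sets (path_algebra M)" if "es \<noteq> []"
    using that assms by (intro sets.finite_INT) (auto intro!: singleton_measurable_alphabet)
  ultimately show ?thesis
    by (cases "es = []") (auto simp: cylinder_Nil space_path_algebra[symmetric])
qed

text \<open>With countably many edges there are only countably many cylinders, so the union that
  exhausts an open set is a countable one.\<close>

lemma sets_path_algebra_cylinders:
  assumes "countable (edges M)"
  shows "sets (path_algebra M) = sigma_sets (UNIV \<rightarrow>\<^sub>E alphabet M) (cylinders M)"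
proof
  show "sigma_sets (UNIV \<rightarrow>\<^sub>E alphabet M) (cylinders M) \<subseteq> sets (path_algebra M)"
    unfolding space_path_algebra[symmetric]
    by (intro sets.sigma_sets_subset) (auto simp: cylinders_def intro!: cylinder_measurable)
  have sub: "cylinders M \<subseteq> Pow (UNIV \<rightarrow>\<^sub>E alphabet M)"
    by (auto simp: cylinders_def cylinder_eq)
  interpret S: sigma_algebra "UNIV \<rightarrow>\<^sub>E alphabet M" "sigma_sets (UNIV \<rightarrow>\<^sub>E alphabet M) (cylinders M)"
    by (rule sigma_algebra_sigma_sets[OF sub])
  show "sets (path_algebra M) \<subseteq> sigma_sets (UNIV \<rightarrow>\<^sub>E alphabet M) (cylinders M)"
    unfolding sets_path_algebra
  proof (rule S.sigma_sets_subset, safe)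
    fix U assume "openin (path_topology M) U"
    then have eq: "U = \<Union>{C \<in> cylinders M. C \<subseteq> U}" by (rule open_eq_Union_cylinders)
    have "countable {C \<in> cylinders M. C \<subseteq> U}"
      by (rule countable_subset[OF _ countable_cylinders[OF assms]]) auto
    then have "\<Union>{C \<in> cylinders M. C \<subseteq> U} \<in> sigma_sets (UNIV \<rightarrow>\<^sub>E alphabet M) (cylinders M)"
      by (rule S.countable_Union) auto
    with eq show "U \<in> sigma_sets (UNIV \<rightarrow>\<^sub>E alphabet M) (cylinders M)" by simp
  qed
qed

text \<open>Ionescu-Tulcea produces a measure on the product algebra over discrete coordinates; this
  identifies that algebra with the Borel sets of path space.\<close>

lemma sets_path_algebra_PiM:
  assumes "countable (edges M)"
  shows "sets (path_algebra M) = sets (PiM UNIV (\<lambda>_. count_space (alphabet M)))"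
    (is "_ = sets ?P")
proof
  have sp: "space ?P = UNIV \<rightarrow>\<^sub>E alphabet M" by (simp add: space_PiM)
  have ctbl: "countable (alphabet M)" using assms by (simp add: alphabet_def)
  have "cylinder M es \<in> sets ?P" if "set es \<subseteq> alphabet M" for es
  proof -
    have "{\<sigma> \<in> space ?P. \<forall>k\<in>{..<length es}. \<sigma> k = es ! k} \<in> sets ?P"
      by (intro sets.sets_Collect_finite_All) (use that in measurable)
    then show ?thesis unfolding cylinder_eq sp by (simp only: lessThan_iff Ball_def)
  qed
  then show "sets (path_algebra M) \<subseteq> sets ?P"
    unfolding sets_path_algebra_cylinders[OF assms] sp[symmetric]
    by (intro sets.sigma_sets_subset) (auto simp: cylinders_def)
  \<comment> \<open>The coordinates are Borel measurable, hence so is the identity into the product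
    algebra, and preimages under it give the remaining inclusion.\<close>
  have meas: "(\<lambda>\<sigma>. \<sigma>) \<in> measurable (path_algebra M) ?P"
  proof (rule measurable_PiM_single'[where f="\<lambda>i \<sigma>. \<sigma> i"])
    show "(\<lambda>\<sigma>. \<sigma> i) \<in> measurable (path_algebra M) (count_space (alphabet M))" for i
      unfolding measurable_count_space_eq_countable[OF ctbl]
    proof safe
      fix a assume "a \<in> alphabet M"
      from singleton_measurable_alphabet[OF this]
      show "(\<lambda>\<sigma>. \<sigma> i) -` {a} \<inter> space (path_algebra M) \<in> sets (path_algebra M)"
        by (simp add: space_path_algebra vimage_def Int_def conj_commute)
    qed (auto simp: space_path_algebra)
  qed (auto simp: space_path_algebra)
  show "sets ?P \<subseteq> sets (path_algebra M)"
  proof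
    fix A assume A: "A \<in> sets ?P"
    then have "A \<subseteq> space (path_algebra M)"
      using sets.sets_into_space[OF A] by (simp only: sp space_path_algebra)
    with measurable_sets[OF meas A] show "A \<in> sets (path_algebra M)"
      by (simp add: Int_absorb2)
  qed
qed

section \<open>Uniqueness of path measures\<close>

lemma Int_stable_cylinders: "Int_stable (insert {} (cylinders M))"
proof -
  \<comment> \<open>Two cylinders are nested or disjoint, as the longer word either extends the
    shorter one or contradicts it. Disjoint pairs are why \<open>{}\<close> is added to the
    generator.\<close>
  have *: "cylinder M es \<inter> cylinder M fs \<in> {{}, cylinder M fs}" if "length es \<le> length fs" for es fs
  proof (cases "\<forall>k<length es. es ! k = fs ! k")
    case True
    then have "cylinder M es \<inter> cylinder M fs = cylinder M fs"
      using that by (auto simp: cylinder_eq)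
    then show ?thesis by simp
  next
    case False
    then have "cylinder M es \<inter> cylinder M fs = {}"
      using that by (auto simp: cylinder_eq)
    then show ?thesis by simp
  qed
  show ?thesis
  proof (rule Int_stableI)
    fix A B assume AB: "A \<in> insert {} (cylinders M)" "B \<in> insert {} (cylinders M)"
    show "A \<inter> B \<in> insert {} (cylinders M)"
    proof (cases "A = {} \<or> B = {}")
      case False
      with AB obtain es fs where "A = cylinder M es" "B = cylinder M fs"
        by (auto simp: cylinders_def)
      then have "A \<inter> B \<in> {{}, A, B}"
        using *[of es fs] *[of fs es] by (cases "length es \<le> length fs") (auto simp: Int_commute)
      with AB show ?thesis by fastforce
    qed auto
  qed
qed

lemma is_path_measure_cylinder:
  assumes "is_path_measure M x P" "set es \<subseteq> alphabet M"
  shows "measure P (cylinder M es) = path_weight M x es"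
proof (cases "es = []")
  case True
  have "prob_space P" "space P = cylinder M []"
    using assms(1) by (auto simp: is_path_measure_def cylinder_Nil space_path_algebra)
  then show ?thesis using True prob_space.prob_space by fastforce
next
  case False
  with assms show ?thesis by (auto simp: is_path_measure_def alphabet_def)
qed

text \<open>Finite measures that agree on an intersection-stable generator are equal; the cylinder
  of the empty word serves as the exhausting set.\<close>

lemma is_path_measure_unique:
  assumes "countable (edges M)" "is_path_measure M x P" "is_path_measure M x Q"
  shows "P = Q"
proof (rule measure_eqI_generator_eq_countable)
  interpret P: prob_space P using assms(2) by (simp add: is_path_measure_def)
  interpret Q: prob_space Q using assms(3) by (simp add: is_path_measure_def)
  let ?E = "insert {} (cylinders M)" and ?S = "UNIV \<rightarrow>\<^sub>E alphabet M"
  show "Int_stable ?E" by (rule Int_stable_cylinders)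
  show "?E \<subseteq> Pow ?S" by (auto simp: cylinders_def cylinder_eq)
  show "emeasure P X = emeasure Q X" if "X \<in> ?E" for X
  proof (cases "X = {}")
    case False
    with that obtain es where "set es \<subseteq> alphabet M" "X = cylinder M es"
      by (auto simp: cylinders_def)
    then show ?thesis
      by (simp add: P.emeasure_eq_measure Q.emeasure_eq_measure
          is_path_measure_cylinder[OF assms(2)] is_path_measure_cylinder[OF assms(3)])
  qed simp
  have "sigma_sets ?S ?E = sigma_sets ?S (cylinders M)"
    by (rule sigma_sets_eqI) (auto intro: sigma_sets.Basic sigma_sets.Empty)
  then show "sets P = sigma_sets ?S ?E" "sets Q = sigma_sets ?S ?E"
    using assms by (auto simp: is_path_measure_def sets_path_algebra_cylinders)
  show "{cylinder M []} \<subseteq> ?E" "\<Union>{cylinder M []} = ?S"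
    using image_eqI[of "cylinder M []" "cylinder M" "[]"] by (auto simp: cylinders_def cylinder_Nil)
  show "emeasure P C \<noteq> \<infinity>" for C by (simp add: P.emeasure_eq_measure)
qed simp_all

lemma path_measure_eqI:
  assumes "countable (edges M)" "is_path_measure M x P"
  shows "path_measure M x = P"
  unfolding path_measure_def
  by (rule the_equality[where P="is_path_measure M x", OF assms(2)])
    (rule is_path_measure_unique[OF assms(1) _ assms(2)])

section \<open>Existence of path measures\<close>

text \<open>Here \<open>fold (wmap_ext M) es x\<close> is the point reached from \<open>x\<close>
  along the word \<open>es\<close>.\<close>

lemma path_weight_append:
  "path_weight M x (es @ fs) = path_weight M x es * path_weight M (fold (wmap_ext M) es x) fs"
  by (induction es arbitrary: x) simp_all

lemma pfun_ext_nonneg: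
  assumes "markov_system M" "e \<in> alphabet M"
  shows "0 \<le> pfun_ext M e x"
  using assms by (auto simp: markov_system_def alphabet_def pfun_ext_def)

lemma path_weight_nonneg:
  assumes "markov_system M" "set es \<subseteq> alphabet M"
  shows "0 \<le> path_weight M x es"
  using assms(2) by (induction es arbitrary: x) (auto intro!: mult_nonneg_nonneg pfun_ext_nonneg[OF assms(1)])

text \<open>Infinity has probability 0, so the total mass is the sum over the edges. This makes the
  transition kernels below probability measures.\<close>

lemma nn_integral_pfun_ext:
  assumes "markov_system M"
  shows "(\<integral>\<^sup>+e. ennreal (pfun_ext M e x) \<partial>count_space (alphabet M)) = 1"
proof -
  have "((\<lambda>e. pfun M e x) has_sum 1) (edges M)"
    using assms by (simp add: markov_system_def)
  then have "((\<lambda>e. pfun_ext M e x) has_sum 1) (Some ` edges M)"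
    by (subst has_sum_reindex) (simp_all add: comp_def pfun_ext_def)
  then have sum: "((\<lambda>e. pfun_ext M e x) has_sum 1) (alphabet M)"
    by (subst has_sum_cong_neutral[where T="Some ` edges M"])
      (auto simp: alphabet_def pfun_ext_def)
  then have "(\<lambda>e. pfun_ext M e x) summable_on alphabet M"
    by (rule has_sum_imp_summable)
  then have abs: "Infinite_Set_Sum.abs_summable_on (\<lambda>e. pfun_ext M e x) (alphabet M)"
    by (simp add: abs_summable_equivalent[symmetric] pfun_ext_nonneg[OF assms] cong: summable_on_cong)
  have "(\<integral>\<^sup>+e. ennreal (pfun_ext M e x) \<partial>count_space (alphabet M)) =
      ennreal (infsetsum (\<lambda>e. pfun_ext M e x) (alphabet M))"
    by (rule nn_integral_conv_infsetsum[OF abs pfun_ext_nonneg[OF assms]])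
  also have "infsetsum (\<lambda>e. pfun_ext M e x) (alphabet M) = 1"
    using infsumI[OF sum] infsetsum_infsum[OF abs] by simp
  finally show ?thesis by simp
qed

text \<open>The law of the letter at position \<open>n\<close> given the letters before it: the edge
  probabilities at the point to which these letters have moved \<open>x\<close>.\<close>

definition path_kernel ::
  "('a, 'v, 'e) markov_data \<Rightarrow> 'a \<Rightarrow> nat \<Rightarrow> (nat \<Rightarrow> 'e option) \<Rightarrow> 'e option measure" where
  "path_kernel M x n \<sigma> = density (count_space (alphabet M))
     (\<lambda>e. ennreal (pfun_ext M e (fold (wmap_ext M) (map \<sigma> [0..<n]) x)))"

lemma Ionescu_Tulcea_path_kernel:
  assumes "markov_system M"
  shows "Ionescu_Tulcea (path_kernel M x) (\<lambda>_. count_space (alphabet M))"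
proof (rule Ionescu_Tulcea.intro)
  fix n :: nat
  have ctbl: "countable (alphabet M)"
    using assms by (simp add: alphabet_def markov_system_def)
  have prob: "prob_space (path_kernel M x n \<sigma>)" for \<sigma>
  proof (rule prob_spaceI)
    let ?f = "\<lambda>e. ennreal (pfun_ext M e (fold (wmap_ext M) (map \<sigma> [0..<n]) x))"
    have "emeasure (path_kernel M x n \<sigma>) (space (path_kernel M x n \<sigma>)) =
        (\<integral>\<^sup>+e. ?f e * indicator (alphabet M) e \<partial>count_space (alphabet M))"
      by (simp add: path_kernel_def emeasure_density)
    also have "\<dots> = (\<integral>\<^sup>+e. ?f e \<partial>count_space (alphabet M))"
      by (rule nn_integral_cong) simp
    finally show "emeasure (path_kernel M x n \<sigma>) (space (path_kernel M x n \<sigma>)) = 1"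
      by (simp add: nn_integral_pfun_ext[OF assms])
  qed
  show "prob_space (path_kernel M x n \<sigma>)" for \<sigma>
    by (rule prob)
  have "path_kernel M x n \<sigma> \<in> space (subprob_algebra (count_space (alphabet M)))" for \<sigma>
    using prob_space_imp_subprob_space[OF prob]
    by (auto simp: space_subprob_algebra path_kernel_def)
  \<comment> \<open>A finite product of countable discrete spaces is discrete, so measurability in
    the history only asks that the values are subprobabilities.\<close>
  then show "path_kernel M x n \<in> measurable (PiM {0..<n} (\<lambda>_. count_space (alphabet M)))
      (subprob_algebra (count_space (alphabet M)))"
    by (subst count_space_PiM_finite) (auto intro: ctbl)
qed

text \<open>Ionescu-Tulcea glues the kernels to a measure \<open>PF.lim\<close> whose first
  \<open>n\<close> coordinates have law \<open>C 0 n\<close>. That law lives on a discrete space, so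
  masses of single points suffice; by induction each kernel contributes one factor of the path
  weight.\<close>

lemma is_path_measure_exists:
  fixes M :: "('a::metric_space, 'v, 'e) markov_data"
  assumes "markov_system M"
  shows "\<exists>P. is_path_measure M x P"
proof -
  let ?A = "alphabet M"
  let ?C = "count_space ?A"
  have ctbl: "countable ?A" "countable (edges M)"
    using assms by (simp_all add: alphabet_def markov_system_def)
  interpret Ionescu_Tulcea "path_kernel M x" "\<lambda>_. ?C"
    by (rule Ionescu_Tulcea_path_kernel[OF assms])
  have PiM: "PiM {0..<n} (\<lambda>_. ?C) = count_space ({0..<n} \<rightarrow>\<^sub>E ?A)" for n :: nat
    by (rule count_space_PiM_finite) (auto intro: ctbl)
  \<comment> \<open>The empty history, sole element of the product over no coordinates.\<close>
  have undef: "(\<lambda>_. undefined) \<in> space (PiM {0..<0::nat} (\<lambda>_. ?C))"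
    by (simp add: space_PiM PiE_iff extensional_def)
  have C: "emeasure (C 0 n (\<lambda>_. undefined)) {\<sigma>} = path_weight M x (map \<sigma> [0..<n])"
    if "\<sigma> \<in> {0..<n} \<rightarrow>\<^sub>E ?A" for n \<sigma>
    using that
  proof (induction n arbitrary: \<sigma>)
    case 0
    then show ?case by (simp add: emeasure_return sets_PiM_empty)
  next
    case (Suc n)
    let ?\<rho> = "restrict \<sigma> {0..<n}"
    have \<rho>: "?\<rho> \<in> {0..<n} \<rightarrow>\<^sub>E ?A" and \<sigma>n: "\<sigma> n \<in> ?A" using Suc.prems by auto
    have \<rho>\<sigma>: "?\<rho>(n := \<sigma> n) = \<sigma>"
      using Suc.prems by (auto simp: fun_eq_iff PiE_iff extensional_def)
    have map\<rho>: "map ?\<rho> [0..<n] = map \<sigma> [0..<n]" by simp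
    let ?p = "ennreal (pfun_ext M (\<sigma> n) (fold (wmap_ext M) (map \<sigma> [0..<n]) x))"
    \<comment> \<open>Appending a letter to the history yields the given word only for one history
      and one letter, so the integrand below is a multiple of an indicator.\<close>
    have step: "emeasure (eP n \<omega>) {\<sigma>} = ?p * indicator {?\<rho>} \<omega>"
      if \<omega>: "\<omega> \<in> {0..<n} \<rightarrow>\<^sub>E ?A" for \<omega>
    proof -
      have "emeasure (eP n \<omega>) {\<sigma>} = emeasure (path_kernel M x n \<omega>) (fun_upd \<omega> n -` {\<sigma>} \<inter> ?A)"
        using \<omega> Suc.prems by (subst emeasure_eP) (simp_all add: PiM)
      also have "fun_upd \<omega> n -` {\<sigma>} \<inter> ?A = (if \<omega> = ?\<rho> then {\<sigma> n} else {})"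
      proof -
        have \<omega>_eq: "\<omega> = ?\<rho>" if "fun_upd \<omega> n e = \<sigma>" for e
        proof
          fix k show "\<omega> k = ?\<rho> k"
            using fun_cong[OF that, of k] \<omega> by (cases "k < n") (auto simp: PiE_iff extensional_def)
        qed
        have "fun_upd \<omega> n e = \<sigma> \<longleftrightarrow> \<omega> = ?\<rho> \<and> e = \<sigma> n" for e
        proof
          assume upd: "fun_upd \<omega> n e = \<sigma>"
          with fun_cong[OF upd, of n] \<omega>_eq[OF upd] show "\<omega> = ?\<rho> \<and> e = \<sigma> n"
            by (simp only: fun_upd_same)
        next
          assume "\<omega> = ?\<rho> \<and> e = \<sigma> n"
          then show "fun_upd \<omega> n e = \<sigma>" using \<rho>\<sigma> by (simp only:)
        qed
        then have "fun_upd \<omega> n -` {\<sigma>} \<inter> ?A = {e \<in> ?A. \<omega> = ?\<rho> \<and> e = \<sigma> n}"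
          by (simp only: vimage_def singleton_iff Int_def mem_Collect_eq conj_commute)
        also have "\<dots> = (if \<omega> = ?\<rho> then {\<sigma> n} else {})"
          using \<sigma>n by auto
        finally show ?thesis .
      qed
      also have "emeasure (path_kernel M x n \<omega>) \<dots> = ?p * indicator {?\<rho>} \<omega>"
        using \<sigma>n by (auto simp: path_kernel_def emeasure_density map\<rho>)
      finally show ?thesis .
    qed
    have sp: "space (C 0 n (\<lambda>_. undefined)) = {0..<n} \<rightarrow>\<^sub>E ?A"
      using space_C[OF undef, of n] by (simp add: PiM)
    have st: "sets (C 0 n (\<lambda>_. undefined)) = Pow ({0..<n} \<rightarrow>\<^sub>E ?A)"
      using sets_C[OF undef, of n] by (simp add: PiM)
    have "emeasure (C 0 (Suc n) (\<lambda>_. undefined)) {\<sigma>} =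
        (\<integral>\<^sup>+\<omega>. emeasure (eP n \<omega>) {\<sigma>} \<partial>C 0 n (\<lambda>_. undefined))"
      unfolding C.simps add_0
    proof (rule emeasure_bind[where N="PiM {0..<Suc n} (\<lambda>_. ?C)"])
      show "space (C 0 n (\<lambda>_. undefined)) \<noteq> {}" unfolding sp using \<rho> by blast
      show "eP n \<in> measurable (C 0 n (\<lambda>_. undefined)) (subprob_algebra (PiM {0..<Suc n} (\<lambda>_. ?C)))"
        using measurable_eP[of n] sets_C[OF undef, of n] by (simp cong: measurable_cong_sets)
      show "{\<sigma>} \<in> sets (PiM {0..<Suc n} (\<lambda>_. ?C))" using Suc.prems by (simp add: PiM)
    qed
    also have "\<dots> = (\<integral>\<^sup>+\<omega>. ?p * indicator {?\<rho>} \<omega> \<partial>C 0 n (\<lambda>_. undefined))"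
      by (rule nn_integral_cong) (simp add: sp step)
    also have "\<dots> = ?p * emeasure (C 0 n (\<lambda>_. undefined)) {?\<rho>}"
      using \<rho> by (intro nn_integral_cmult_indicator) (simp add: st)
    also have "\<dots> = ?p * ennreal (path_weight M x (map \<sigma> [0..<n]))"
      by (simp only: Suc.IH[OF \<rho>] map\<rho>)
    also have "\<dots> = ennreal (path_weight M x (map \<sigma> [0..<Suc n]))"
    proof -
      have "0 \<le> path_weight M x (map \<sigma> [0..<n])"
        using Suc.prems by (intro path_weight_nonneg[OF assms]) auto
      moreover have "0 \<le> pfun_ext M (\<sigma> n) y" for y
        by (rule pfun_ext_nonneg[OF assms \<sigma>n])
      ultimately show ?thesis
        by (simp add: path_weight_append ennreal_mult[symmetric] mult.commute)
    qed
    finally show ?case .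
  qed
  have "is_path_measure M x PF.lim"
    unfolding is_path_measure_def
  proof (intro conjI allI impI; (elim conjE)?)
    show "prob_space PF.lim"
    proof (rule prob_spaceI)
      let ?E = "PiM {} (\<lambda>_. ?C) :: (nat \<Rightarrow> 'e option) measure"
      \<comment> \<open>The whole space is the cylinder over the empty set of coordinates, so its
        mass can be read off from a finite-dimensional law.\<close>
      have "PF.emb UNIV {} (space ?E) = space PF.lim"
        by (auto simp: prod_emb_def space_PiM)
      then have "emeasure PF.lim (space PF.lim) = emeasure (CI {}) (space ?E)"
        using lim[of "{}" "space ?E"] by simp
      also have "space ?E = space (CI {})" by (simp add: CI_def)
      also have "emeasure (CI {}) \<dots> = 1"
        by (rule prob_space.emeasure_space_1[OF PF.prob_space_P]) simp_all
      finally show "emeasure PF.lim (space PF.lim) = 1" .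
    qed
    show sets: "sets PF.lim = sets (path_algebra M)"
      by (simp add: sets_path_algebra_PiM[OF ctbl(2)])
    then show "space PF.lim = space (path_algebra M)"
      by (rule sets_eq_imp_space_eq)
    fix es assume "set es \<subseteq> insert None (Some ` edges M)"
    then have es: "set es \<subseteq> ?A" by (simp add: alphabet_def)
    define n where "n = length es"
    define \<rho> where "\<rho> = restrict (\<lambda>i. es ! i) {0..<n}"
    have \<rho>: "\<rho> \<in> {0..<n} \<rightarrow>\<^sub>E ?A" using es by (auto simp: \<rho>_def n_def)
    have map\<rho>: "map \<rho> [0..<n] = es" by (auto simp: \<rho>_def n_def intro: nth_equalityI)
    have "cylinder M es = PF.emb UNIV {0..<n} {\<rho>}"
      by (auto simp: cylinder_eq prod_emb_def \<rho>_def n_def fun_eq_iff restrict_def) metis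
    then have "emeasure PF.lim (cylinder M es) = emeasure (CI {0..<n}) {\<rho>}"
      using \<rho> by (simp add: lim PiM)
    \<comment> \<open>\<open>CI\<close> may be evaluated at any level that bounds the coordinates;
      at level \<open>n\<close> the embedding is the identity.\<close>
    also have "\<dots> = emeasure (C 0 n (\<lambda>_. undefined)) (PF.emb {0..<n} {0..<n} {\<rho>})"
      using \<rho> by (intro emeasure_CI) (simp_all add: PiM)
    also have "PF.emb {0..<n} {0..<n} {\<rho>} = {\<rho>}"
      using \<rho> by (intro prod_emb_id) simp
    also have "emeasure (C 0 n (\<lambda>_. undefined)) {\<rho>} = path_weight M x es"
      by (simp add: C[OF \<rho>] map\<rho>)
    finally show "measure PF.lim (cylinder M es) = path_weight M x es"
      by (simp add: measure_def path_weight_nonneg[OF assms es])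
  qed
  then show ?thesis ..
qed

lemma is_path_measure_path_measure:
  assumes "markov_system M"
  shows "is_path_measure M x (path_measure M x)"
proof -
  obtain P where "is_path_measure M x P" using is_path_measure_exists[OF assms] by blast
  moreover have "countable (edges M)" using assms by (simp add: markov_system_def)
  ultimately show ?thesis using path_measure_eqI by metis
qed

section \<open>Path measures under refinement\<close>

definition relabel_path :: "('f \<Rightarrow> 'e) \<Rightarrow> (nat \<Rightarrow> 'f option) \<Rightarrow> nat \<Rightarrow> 'e option" where
  "relabel_path r \<sigma> = (\<lambda>k. map_option r (\<sigma> k))"

text \<open>Relabelling need not be continuous: infinitely many edges over one edge may converge to
  infinity while their image stays constant. Measurability is therefore checked by coordinates in
  the product algebra.\<close>

lemma measurable_relabel_path:
  assumes "countable (edges M)" "countable (edges R)" "r ` edges R = edges M"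
  shows "relabel_path r \<in> measurable (path_algebra R) (path_algebra M)"
proof -
  have r: "map_option r \<in> alphabet R \<rightarrow> alphabet M"
    using assms(3) by (auto simp: alphabet_def)
  have "relabel_path r \<in> measurable (PiM UNIV (\<lambda>_. count_space (alphabet R)))
      (PiM UNIV (\<lambda>_. count_space (alphabet M)))"
    unfolding relabel_path_def[abs_def]
  proof (rule measurable_PiM_single')
    show "(\<lambda>\<sigma>. map_option r (\<sigma> k)) \<in> measurable (PiM UNIV (\<lambda>_. count_space (alphabet R)))
        (count_space (alphabet M))" for k
      by (rule measurable_compose[OF measurable_component_singleton[of k]]) (use r in auto)
  qed (use r in \<open>fastforce simp: space_PiM\<close>)
  then show ?thesis
    by (simp add: measurable_cong_sets[OF sets_path_algebra_PiM[OF assms(2)] sets_path_algebra_PiM[OF assms(1)]])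
qed

lemma relabel_path_vimage_cylinder:
  assumes "r ` edges R = edges M"
  shows "relabel_path r -` cylinder M es \<inter> space (path_algebra R) =
    (\<Union>fs\<in>{fs. set fs \<subseteq> alphabet R \<and> map (map_option r) fs = es}. cylinder R fs)"
  (is "?lhs = ?rhs")
proof
  show "?lhs \<subseteq> ?rhs"
  proof
    fix \<sigma> assume "\<sigma> \<in> ?lhs"
    then have \<sigma>: "relabel_path r \<sigma> \<in> cylinder M es" "\<sigma> \<in> space (path_algebra R)"
      by simp_all
    let ?fs = "map \<sigma> [0..<length es]"
    have "set ?fs \<subseteq> alphabet R" "\<sigma> \<in> cylinder R ?fs"
      using \<sigma>(2) by (auto simp: space_path_algebra cylinder_eq)
    moreover have "map (map_option r) ?fs = es"
      using \<sigma>(1) by (auto simp: cylinder_eq relabel_path_def intro: nth_equalityI)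
    ultimately show "\<sigma> \<in> ?rhs" by blast
  qed
  have r: "map_option r b \<in> alphabet M" if "b \<in> alphabet R" for b
    using assms that by (auto simp: alphabet_def)
  show "?rhs \<subseteq> ?lhs"
    by (auto simp: cylinder_eq relabel_path_def space_path_algebra PiE_iff intro: r)
qed

text \<open>Fixes the map that \<open>refinement\<close> only asserts to exist, so that it can be
  applied to paths.\<close>

locale refinement_map =
  fixes M :: "('a::metric_space, 'v, 'e) markov_data" and R :: "('a, 'w, 'f) markov_data"
    and r :: "'f \<Rightarrow> 'e"
  assumes M: "markov_system M" and R: "markov_system R"
    and r: "r ` edges R = edges M"
    and inj: "\<And>j. j \<in> vertices R \<Longrightarrow> inj_on r {f \<in> edges R. initv R f = j}"
    and eq: "\<And>f x. f \<in> edges R \<Longrightarrow> x \<in> cell R (initv R f) \<Longrightarrow>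
      wmap M (r f) x = wmap R f x \<and> pfun M (r f) x = pfun R f x"
begin

text \<open>The edge of R over e that starts in the cell of x carries the whole probability of e at x.
  If there is none, then the edges leaving that cell already exhaust the total mass 1, so e has
  probability 0 at x. This is where the injectivity of r on the edges leaving a vertex is used.\<close>

lemma edge_lift:
  assumes e: "e \<in> edges M"
  shows "(pfun M e x = 0 \<and> (\<forall>f\<in>edges R. r f = e \<longrightarrow> pfun R f x = 0)) \<or>
    (\<exists>f\<in>edges R. r f = e \<and> pfun R f x = pfun M e x \<and> wmap R f x = wmap M e x \<and>
      (\<forall>g\<in>edges R. r g = e \<and> g \<noteq> f \<longrightarrow> pfun R g x = 0))"
proof -
  have "x \<in> (\<Union>j\<in>vertices R. cell R j)"
    using R by (simp add: markov_system_def)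
  then obtain j where j: "j \<in> vertices R" "x \<in> cell R j" by blast
  let ?L = "{f \<in> edges R. initv R f = j}"
  \<comment> \<open>Only edges leaving the cell of \<open>x\<close> can have positive probability at
    \<open>x\<close>, because the cells are disjoint.\<close>
  have zero: "pfun R f x = 0" if "f \<in> edges R" "initv R f \<noteq> j" for f
  proof (rule ccontr)
    assume "pfun R f x \<noteq> 0"
    moreover have "0 \<le> pfun R f x" "{x. pfun R f x > 0} \<subseteq> cell R (initv R f)"
      using R that(1) by (simp_all add: markov_system_def)
    ultimately have "x \<in> cell R (initv R f)" by auto
    moreover have "initv R ` edges R = vertices R" "disjoint_family_on (cell R) (vertices R)"
      using R by (simp_all add: markov_system_def)
    ultimately show False using j that unfolding disjoint_family_on_def by blast
  qed
  show ?thesis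
  proof (cases "e \<in> r ` ?L")
    case True
    then obtain f where f: "f \<in> edges R" "initv R f = j" "r f = e" by auto
    have "pfun R g x = 0" if "g \<in> edges R" "r g = e" "g \<noteq> f" for g
      using zero[OF that(1)] inj_onD[OF inj[OF j(1)], of g f] f that by auto
    then show ?thesis using f eq[OF f(1), of x] j by auto
  next
    case False
    have "((\<lambda>f. pfun R f x) has_sum 1) (edges R)"
      using R by (simp add: markov_system_def)
    then have "((\<lambda>f. pfun R f x) has_sum 1) ?L"
      by (subst (asm) has_sum_cong_neutral[where T="?L"]) (auto intro: zero)
    then have "((\<lambda>f. pfun M (r f) x) has_sum 1) ?L"
      by (rule has_sum_cong[THEN iffD1, rotated]) (use eq j in auto)
    then have sum1: "((\<lambda>e. pfun M e x) has_sum 1) (r ` ?L)"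
      by (subst has_sum_reindex[OF inj[OF j(1)]]) (simp add: comp_def)
    \<comment> \<open>Adjoining \<open>e\<close> to edges that already have total mass 1 must not
      exceed the sum over all edges, which is 1 too.\<close>
    then have "((\<lambda>e. pfun M e x) has_sum (pfun M e x + 1)) (insert e (r ` ?L))"
      by (rule has_sum_insert[OF False])
    moreover have "((\<lambda>e. pfun M e x) has_sum 1) (edges M)"
      using M by (simp add: markov_system_def)
    ultimately have "pfun M e x + 1 \<le> 1"
      by (rule has_sum_mono2) (use M e r in \<open>auto simp: markov_system_def\<close>)
    moreover have "0 \<le> pfun M e x" using M e by (simp add: markov_system_def)
    ultimately have "pfun M e x = 0" by simp
    moreover have "pfun R f x = 0" if "f \<in> edges R" "r f = e" for f
      using zero[OF that(1)] False that by auto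
    ultimately show ?thesis by blast
  qed
qed

text \<open>Iterates \<open>edge_lift\<close> letter by letter: as the lifted edge moves
  \<open>x\<close> to the same point, the induction continues from there. The full weight sits on a
  single lifted word.\<close>

lemma path_lift:
  assumes es: "set es \<subseteq> alphabet M"
  shows "\<exists>fs. set fs \<subseteq> alphabet R \<and> map (map_option r) fs = es \<and>
    path_weight R x fs = path_weight M x es \<and>
    (\<forall>gs. set gs \<subseteq> alphabet R \<longrightarrow> map (map_option r) gs = es \<longrightarrow> gs \<noteq> fs \<longrightarrow>
      path_weight R x gs = 0)"
  using es
proof (induction es arbitrary: x)
  case Nil
  then show ?case by auto
next
  case (Cons a es)
  have a: "\<exists>b\<in>alphabet R. map_option r b = a \<and> pfun_ext R b x = pfun_ext M a x \<and>
      (pfun_ext M a x = 0 \<or> wmap_ext R b x = wmap_ext M a x) \<and>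
      (\<forall>c\<in>alphabet R. map_option r c = a \<longrightarrow> c \<noteq> b \<longrightarrow> pfun_ext R c x = 0)"
  proof (cases a)
    case None
    then show ?thesis
      by (intro bexI[of _ None]) (auto simp: pfun_ext_def alphabet_def)
  next
    case (Some e)
    then have e: "e \<in> edges M" using Cons.prems by (auto simp: alphabet_def)
    from edge_lift[OF e, of x] show ?thesis
    proof (elim disjE conjE bexE)
      assume *: "pfun M e x = 0" "\<forall>f\<in>edges R. r f = e \<longrightarrow> pfun R f x = 0"
      \<comment> \<open>Any preimage under the surjection \<open>r\<close> will do, since all have
        probability 0 at \<open>x\<close>.\<close>
      obtain f where "f \<in> edges R" "r f = e"
        using e unfolding r[symmetric] by auto
      with * Some show ?thesis
        by (intro bexI[of _ "Some f"]) (auto simp: pfun_ext_def alphabet_def)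
    next
      fix f assume "f \<in> edges R" "r f = e" "pfun R f x = pfun M e x" "wmap R f x = wmap M e x"
        "\<forall>g\<in>edges R. r g = e \<and> g \<noteq> f \<longrightarrow> pfun R g x = 0"
      with Some show ?thesis
        by (intro bexI[of _ "Some f"]) (auto simp: pfun_ext_def wmap_ext_def alphabet_def)
    qed
  qed
  then obtain b where b: "b \<in> alphabet R" "map_option r b = a" "pfun_ext R b x = pfun_ext M a x"
      "pfun_ext M a x = 0 \<or> wmap_ext R b x = wmap_ext M a x"
      "\<And>c. c \<in> alphabet R \<Longrightarrow> map_option r c = a \<Longrightarrow> c \<noteq> b \<Longrightarrow> pfun_ext R c x = 0"
    by blast
  have es: "set es \<subseteq> alphabet M" using Cons.prems by simp
  from Cons.IH[OF es, of "wmap_ext M a x"] obtain fs where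
    fs: "set fs \<subseteq> alphabet R" "map (map_option r) fs = es"
      "path_weight R (wmap_ext M a x) fs = path_weight M (wmap_ext M a x) es"
      "\<And>gs. set gs \<subseteq> alphabet R \<Longrightarrow> map (map_option r) gs = es \<Longrightarrow> gs \<noteq> fs \<Longrightarrow>
        path_weight R (wmap_ext M a x) gs = 0"
    by blast
  show ?case
  proof (intro exI[of _ "b # fs"] conjI allI impI)
    show "set (b # fs) \<subseteq> alphabet R" "map (map_option r) (b # fs) = a # es"
      using b(1,2) fs(1,2) by simp_all
    show "path_weight R x (b # fs) = path_weight M x (a # es)"
      using b(3,4) fs(3) by auto
    fix gs assume gs: "set gs \<subseteq> alphabet R" "map (map_option r) gs = a # es" "gs \<noteq> b # fs"
    then obtain c gs' where gs': "gs = c # gs'" "map_option r c = a" "map (map_option r) gs' = es"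
      by (auto simp: map_eq_Cons_conv)
    show "path_weight R x gs = 0"
    proof (cases "c = b")
      case True
      then show ?thesis using b(3,4) fs(4)[of gs'] gs gs' by auto
    next
      case False
      then show ?thesis using b(5)[of c] gs gs' by auto
    qed
  qed
qed

text \<open>By uniqueness it suffices to measure cylinders. The preimage of a cylinder is a
  countable union of cylinders of \<open>R\<close>, all null except possibly the one from
  \<open>path_lift\<close>, which has the right weight.\<close>

lemma path_measure_eq_distr:
  "path_measure M x = distr (path_measure R x) (path_algebra M) (relabel_path r)"
proof (rule path_measure_eqI)
  let ?P = "path_measure R x"
  show cM: "countable (edges M)" using M by (simp add: markov_system_def)
  have cR: "countable (edges R)" using R by (simp add: markov_system_def)
  have P: "is_path_measure R x ?P" by (rule is_path_measure_path_measure[OF R])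
  then interpret P: prob_space ?P by (simp add: is_path_measure_def)
  have sP: "sets ?P = sets (path_algebra R)" "space ?P = space (path_algebra R)"
    using P by (simp_all add: is_path_measure_def)
  have meas: "relabel_path r \<in> measurable ?P (path_algebra M)"
    using measurable_relabel_path[OF cM cR r] by (simp add: measurable_cong_sets[OF sP(1)])
  show "is_path_measure M x (distr ?P (path_algebra M) (relabel_path r))"
    unfolding is_path_measure_def
  proof (intro conjI allI impI; (elim conjE)?)
    show "prob_space (distr ?P (path_algebra M) (relabel_path r))"
      by (rule P.prob_space_distr[OF meas])
    fix es assume "set es \<subseteq> insert None (Some ` edges M)"
    then have es: "set es \<subseteq> alphabet M" by (simp add: alphabet_def)
    let ?F = "{fs. set fs \<subseteq> alphabet R \<and> map (map_option r) fs = es}"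
    obtain fs where fs: "fs \<in> ?F" "path_weight R x fs = path_weight M x es"
      "\<And>gs. gs \<in> ?F \<Longrightarrow> gs \<noteq> fs \<Longrightarrow> path_weight R x gs = 0"
      using path_lift[OF es, of x] by blast
    have ctbl: "countable ?F"
      by (rule countable_subset[of _ "lists (alphabet R)"]) (use cR in \<open>auto simp: alphabet_def\<close>)
    have null: "(\<Union>gs\<in>?F - {fs}. cylinder R gs) \<in> null_sets ?P"
    proof (rule null_sets_UN')
      fix gs assume gs: "gs \<in> ?F - {fs}"
      then have "measure ?P (cylinder R gs) = 0"
        using is_path_measure_cylinder[OF P, of gs] fs(3)[of gs] by simp
      then show "cylinder R gs \<in> null_sets ?P"
        using gs cylinder_measurable[of gs R]
        by (simp add: null_sets_def sP P.emeasure_eq_measure)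
    qed (use ctbl in auto)
    have "measure (distr ?P (path_algebra M) (relabel_path r)) (cylinder M es) =
        measure ?P (relabel_path r -` cylinder M es \<inter> space ?P)"
      by (rule measure_distr[OF meas cylinder_measurable[OF es]])
    also have "relabel_path r -` cylinder M es \<inter> space ?P =
        cylinder R fs \<union> (\<Union>gs\<in>?F - {fs}. cylinder R gs)"
      unfolding sP relabel_path_vimage_cylinder[OF r] using fs(1) by blast
    also have "measure ?P \<dots> = measure ?P (cylinder R fs)"
      using fs(1) by (intro measure_Un_null_set null) (simp add: sP cylinder_measurable)
    also have "\<dots> = path_weight M x es"
      using is_path_measure_cylinder[OF P, of fs] fs by simp
    finally show "measure (distr ?P (path_algebra M) (relabel_path r)) (cylinder M es) =
        path_weight M x es" .
  qed simp_all
qed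

end

section \<open>Absolute continuity within refined cells and along connecting chains\<close>

lemma refinement_absolutely_continuous:
  assumes ref: "refinement M R" and ac: "absolute_continuity_condition R"
    and j: "j \<in> vertices R" "x \<in> cell R j" "y \<in> cell R j"
  shows "absolutely_continuous (path_measure M y) (path_measure M x)"
proof -
  have M: "markov_system M" and R: "markov_system R"
    using ref by (simp_all add: refinement_def)
  obtain r where "r ` edges R = edges M"
      "\<forall>j\<in>vertices R. inj_on r {e \<in> edges R. initv R e = j}"
      "\<forall>e\<in>edges R. \<forall>x\<in>cell R (initv R e). wmap M (r e) x = wmap R e x \<and> pfun M (r e) x = pfun R e x"
    using ref unfolding refinement_def by (elim conjE exE) (rule that)
  with M R have "refinement_map M R r"
    by (simp add: refinement_map_def)
  then interpret refinement_map M R r .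
  have sets: "sets (path_measure R z) = sets (path_algebra R)" for z
    using is_path_measure_path_measure[OF R] by (simp add: is_path_measure_def)
  have "relabel_path r \<in> measurable (path_algebra R) (path_algebra M)"
    using M R r by (intro measurable_relabel_path) (auto simp: markov_system_def)
  then have meas: "relabel_path r \<in> measurable (path_measure R z) (path_algebra M)" for z
    by (simp add: measurable_cong_sets[OF sets])
  have space: "space (path_measure R z) = space (path_algebra R)" for z
    by (rule sets_eq_imp_space_eq[OF sets])
  \<comment> \<open>Null sets of an image measure are the measurable sets with null preimage, so
    this inclusion passes to the path measures of \<open>M\<close>.\<close>
  have "null_sets (path_measure R y) \<subseteq> null_sets (path_measure R x)"
    using ac j by (auto simp: absolute_continuity_condition_def absolutely_continuous_def)
  then show ?thesis
    unfolding absolutely_continuous_def path_measure_eq_distr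
    by (auto simp: null_sets_distr_iff[OF meas] space)
qed

theorem lemma7:
  fixes M :: "('a::complete_space, 'v, 'e) markov_data"
    and M1 :: "('a, 'v1, 'e1) markov_data"
    and M2 :: "('a, 'v2, 'e2) markov_data"
  assumes "countable_markov_system M"
    and "connecting M M1 M2"
    and "absolute_continuity_condition M1"
    and "absolute_continuity_condition M2"
  shows "absolute_continuity_condition M"
  unfolding absolute_continuity_condition_def
proof (intro ballI)
  fix i x y assume i: "i \<in> vertices M" "x \<in> cell M i" "y \<in> cell M i"
  from conjunct2[OF conjunct2[OF assms(2)[unfolded connecting_def]], THEN bspec, OF i(1),
      THEN bspec, OF i(2), THEN bspec, OF i(3)]
  obtain n :: nat and j j' where n: "n \<ge> 2"
    and j: "j ` {1..n} \<subseteq> vertices M1" "j' ` {1..n} \<subseteq> vertices M2"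
    and x: "x \<in> cell M1 (j 1)" and y: "y \<in> cell M2 (j' n)"
    and meet: "\<forall>m\<in>{1..n-1}. cell M1 (j m) \<inter> cell M2 (j' m) \<noteq> {} \<and>
      cell M1 (j m) \<inter> cell M2 (j' (m + 1)) \<noteq> {}"
    by (elim exE conjE) (rule that)
  have ref: "refinement M M1" "refinement M M2"
    using assms(2) by (simp_all add: connecting_def)
  note ac1 = refinement_absolutely_continuous[OF ref(1) assms(3)]
  note ac2 = refinement_absolutely_continuous[OF ref(2) assms(4)]
  have trans: "absolutely_continuous C A" if "absolutely_continuous B A" "absolutely_continuous C B"
    for A B C :: "(nat \<Rightarrow> 'e option) measure"
    using that unfolding absolutely_continuous_def by blast
  \<comment> \<open>Every point \<open>z\<close> of the cell \<open>j' (m + 1)\<close> of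
    \<open>M2\<close> is reached from \<open>x\<close>. The case \<open>m = n - 1\<close> covers
    \<open>y\<close>, and \<open>n >= 2\<close> ensures that \<open>m = 1\<close> is available as a
    start.\<close>
  have "m < n \<Longrightarrow> z \<in> cell M2 (j' (m + 1)) \<Longrightarrow>
      absolutely_continuous (path_measure M z) (path_measure M x)" if "1 \<le> m" for m z
    using that
  proof (induction m arbitrary: z rule: dec_induct)
    case base
    have "1 \<in> {1..n-1}" using n by simp
    then obtain u where u: "u \<in> cell M1 (j 1)" "u \<in> cell M2 (j' (1 + 1))"
      using bspec[OF meet, of 1] by blast
    have "j 1 \<in> vertices M1" "j' (1 + 1) \<in> vertices M2" using j n by auto
    then show ?case
      using trans[OF ac1[of "j 1" x u] ac2[of "j' (1 + 1)" u z]] x u base by blast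
  next
    case (step m)
    have m: "Suc m \<in> {1..n-1}" using step by auto
    \<comment> \<open>The point \<open>u\<close> lies in the \<open>M2\<close> cell already reached;
      \<open>v\<close> shares an \<open>M1\<close> cell with \<open>u\<close> and the next
      \<open>M2\<close> cell with \<open>z\<close>.\<close>
    obtain u where u: "u \<in> cell M1 (j (Suc m))" "u \<in> cell M2 (j' (m + 1))"
      using bspec[OF meet m] by auto
    obtain v where v: "v \<in> cell M1 (j (Suc m))" "v \<in> cell M2 (j' (Suc m + 1))"
      using bspec[OF meet m] by auto
    have verts: "j (Suc m) \<in> vertices M1" "j' (Suc m + 1) \<in> vertices M2" using j step by auto
    have "absolutely_continuous (path_measure M u) (path_measure M x)"
      using step u by auto
    from trans[OF this ac1[OF verts(1) u(1) v(1)]]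
    show ?case by (rule trans) (rule ac2[OF verts(2) v(2) step.prems(2)])
  qed
  from this[of "n - 1" y] show "absolutely_continuous (path_measure M y) (path_measure M x)"
    using n y by simp
qed

end
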